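(* For $t_k,\nu_k\ge 0$ let $\mathcal T_k=t_k\mathbf I+\nu_k\,y_ky_k^\top$, where $s_k,y_k\in\mathbb R^n$ satisfy $s_k^\top y_k>0$. To control the distribution of the two singular values $\sigma_k^-$ and $\sigma_k^+$ of the search direction matrix $\mathcal P_{k+1}$ by minimizing the gap between them, one takes $$(t_k^*,\nu_k^* ):=\arg\min_{t_k,\nu_k\ge 0}\|\mathcal T_ks_k-y_k\|^2,$$ for which the linear system $$\begin{cases}\|s_k\|^2\,t_k+(s_k^\top y_k)^2\,\nu_k=s_k^\top y_k,\\ (s_k^\top y_k)\,t_k+(s_k^\top y_k)\|y_k\|^2\,\nu_k=\|y_k\|^2\end{cases}$$ is to be solved, yielding $$(t_k^*,\nu_k^* )=\left(0,\frac{1}{s_k^\top y_k}\right).$$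
   Context: $\|\cdot\|$ is the Euclidean norm and $\mathbf I$ the $n\times n$ identity. For minimizing a smooth $f:\mathbb R^n\to\mathbb R$ by iterations $x_{k+1}=x_k+s_k$, put $y_k=\nabla f(x_{k+1})-\nabla f(x_k)$; the Wolfe line search conditions, assumed to hold along a descent direction, guarantee $s_k^\top y_k>0$. The matrix Dai–Liao search direction is $d_{k+1}=-\mathcal P_{k+1}\nabla f(x_{k+1})$ with $$\mathcal P_{k+1}=\mathbf I-\frac{s_ky_k^\top}{s_k^\top y_k}+\mathcal T_k\frac{s_ks_k^\top}{s_k^\top y_k}.$$ The singular values of $\mathcal P_{k+1}$ are $1$ with multiplicity $n-2$, together with $$\sigma_k^\pm=\frac{\|s_k\|}{2(s_k^\top y_k)}\Big(\|\mathcal T_ks_k+y_k\|\pm\|\mathcal T_ks_k-y_k\|\Big).$$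
   Formalization: When s_k and y_k are parallel the arg min and the linear system have further solutions, so (0, 1/(s_k^T y_k)) is shown to be a minimizer and a solution always, and the unique one exactly when s_k is not a multiple of y_k. *)

theory Defs
  imports "HOL-Analysis.Analysis" "HOL-Library.Multiset"
begin

definition outer :: "real^'n \<Rightarrow> real^'n \<Rightarrow> real^'n^'n" where
  "outer u v = (\<chi> i j. u $ i * v $ j)"

definition dl_param_matrix :: "real^'n \<Rightarrow> real \<times> real \<Rightarrow> real^'n^'n" where
  "dl_param_matrix y = (\<lambda>(t, \<nu>). t *\<^sub>R mat 1 + \<nu> *\<^sub>R outer y y)"

definition search_matrix :: "real^'n \<Rightarrow> real^'n \<Rightarrow> real^'n^'n \<Rightarrow> real^'n^'n" where
  "search_matrix s y T =
     mat 1 - (1 / (s \<bullet> y)) *\<^sub>R outer s y + (1 / (s \<bullet> y)) *\<^sub>R (T ** outer s s)"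

text \<open>\<open>S\<close> lists, with multiplicity, the nonnegative square roots of the roots of the
  characteristic polynomial of \<open>A\<^sup>T A\<close>. This determines \<open>S\<close> uniquely.\<close>

definition has_singular_values :: "real^'n^'n \<Rightarrow> real multiset \<Rightarrow> bool" where
  "has_singular_values A S \<longleftrightarrow>
     (\<forall>\<sigma>\<in>#S. 0 \<le> \<sigma>) \<and>
     (\<forall>x. det (mat x - transpose A ** A) = (\<Prod>\<sigma>\<in>#S. x - \<sigma>\<^sup>2))"

definition sigma_plus :: "real^'n \<Rightarrow> real^'n \<Rightarrow> real^'n^'n \<Rightarrow> real" where
  "sigma_plus s y T = norm s / (2 * (s \<bullet> y)) * (norm (T *v s + y) + norm (T *v s - y))"

definition sigma_minus :: "real^'n \<Rightarrow> real^'n \<Rightarrow> real^'n^'n \<Rightarrow> real" where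
  "sigma_minus s y T = norm s / (2 * (s \<bullet> y)) * (norm (T *v s + y) - norm (T *v s - y))"

definition singular_gap :: "real^'n \<Rightarrow> real^'n \<Rightarrow> real \<times> real \<Rightarrow> real" where
  "singular_gap s y p =
     sigma_plus s y (dl_param_matrix y p) - sigma_minus s y (dl_param_matrix y p)"

definition residual_sq :: "real^'n \<Rightarrow> real^'n \<Rightarrow> real \<times> real \<Rightarrow> real" where
  "residual_sq s y p = (norm (dl_param_matrix y p *v s - y))\<^sup>2"

definition feasible :: "real \<times> real \<Rightarrow> bool" where
  "feasible = (\<lambda>(t, \<nu>). 0 \<le> t \<and> 0 \<le> \<nu>)"

definition solves_system :: "real^'n \<Rightarrow> real^'n \<Rightarrow> real \<times> real \<Rightarrow> bool" where
  "solves_system s y = (\<lambda>(t, \<nu>).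
     (norm s)\<^sup>2 * t + (s \<bullet> y)\<^sup>2 * \<nu> = s \<bullet> y \<and>
     (s \<bullet> y) * t + (s \<bullet> y) * (norm y)\<^sup>2 * \<nu> = (norm y)\<^sup>2)"

end

theory Submission
  imports Defs
begin

text \<open>\<open>P\<^sup>T P\<close> differs from the identity by \<open>s u\<^sup>T + y v\<^sup>T\<close> for suitable \<open>u, v\<close>, so its
  characteristic polynomial is \<open>(x - 1)\<^bsup>n-2\<^esup>\<close> times that of a \<open>2 \<times> 2\<close> matrix, and
  the latter has the roots \<open>(\<sigma>\<^sup>-)\<^sup>2\<close> and \<open>(\<sigma>\<^sup>+)\<^sup>2\<close>.
  The gap is an increasing function of the residual \<open>t s + (\<nu> (s \<bullet> y) - 1) y\<close> in norm, and the
  residual vanishes at \<open>(0, 1 / (s \<bullet> y))\<close>; so minimizing means annihilating it. It vanishes at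
  another feasible point only if \<open>s = k y\<close>, e.g. at \<open>(1 / k, 0)\<close>.\<close>

section \<open>Outer products and scalar matrices\<close>

lemma outer_vec: "outer u v *v x = (v \<bullet> x) *\<^sub>R u"
  by (simp add: outer_def matrix_vector_mult_def vec_eq_iff inner_vec_def
      sum_distrib_left mult_ac)

lemma matrix_mul_outer: "A ** outer u v = outer (A *v u) v"
  by (simp add: outer_def matrix_matrix_mult_def matrix_vector_mult_def vec_eq_iff
      sum_distrib_left sum_distrib_right mult.assoc)

lemma outer_mul_matrix: "outer u v ** A = outer u (transpose A *v v)"
  by (simp add: outer_def matrix_matrix_mult_def matrix_vector_mult_def transpose_def vec_eq_iff
      sum_distrib_left sum_distrib_right mult_ac)

lemma transpose_outer: "transpose (outer u v) = outer v u"
  by (simp add: outer_def transpose_def vec_eq_iff mult.commute)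

lemma transpose_add: "transpose (A + B) = transpose A + transpose B"
  by (simp add: transpose_def vec_eq_iff)

lemma matrix_add_rdistrib: "(A + B) ** C = A ** C + B ** C" for C :: "real^'n^'n"
  by (simp add: matrix_matrix_mult_def vec_eq_iff distrib_right sum.distrib)

lemma mat_mult: "mat c ** A = c *\<^sub>R A" for A :: "real^'n^'n"
  by (simp add: mat_def matrix_matrix_mult_def vec_eq_iff if_distrib if_distribR cong: if_cong)

lemma mat_vec: "mat c *v x = c *\<^sub>R x" for x :: "real^'n"
  by (simp add: mat_def matrix_vector_mult_def vec_eq_iff if_distrib if_distribR cong: if_cong)

section \<open>Determinants of low-rank perturbations of scalar matrices\<close>

lemma det_mat: "det (mat c :: real^'n^'n) = c ^ CARD('n)"
  by (simp add: det_diagonal mat_def)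

text \<open>Conjugating with the identity whose column \<open>k\<close> is replaced by \<open>u\<close> (where \<open>u $ k \<noteq> 0\<close>)
  reduces the claim to \<open>u = axis k 1\<close>.\<close>

lemma det_mat_1_add_outer:
  fixes u v :: "real^'n"
  shows "det (mat 1 + outer u v) = 1 + v \<bullet> u"
proof (cases "u = 0")
  case True
  then show ?thesis by (simp add: outer_def vec_eq_iff[symmetric] zero_vec_def[symmetric])
next
  case False
  then obtain k where k: "u $ k \<noteq> 0" by (auto simp: vec_eq_iff)
  define E :: "real^'n^'n" where "E = (\<chi> i j. if j = k then u $ i else mat 1 $ i $ j)"
  define w where "w = transpose E *v v"
  have Ek: "E *v axis k 1 = u"
    by (simp add: E_def matrix_vector_mult_def axis_def vec_eq_iff if_distrib cong: if_cong)
  have det_E: "det E = u $ k"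
    using cramer_lemma[of k "mat 1" u] by (simp add: E_def cong: if_cong)
  \<comment> \<open>Only row \<open>k\<close> differs from the identity, and it combines the rows of
    the identity with coefficients \<open>axis k 1 + w\<close>. In this shape the row version of
    Cramer's lemma reads the determinant off as coefficient \<open>k\<close>.\<close>
  have rows: "mat 1 + outer (axis k 1) w
      = (\<chi> i. if i = k then \<Sum>i\<in>UNIV. (axis k 1 + w) $ i *s row i (mat 1) else row i (mat 1))"
    by (auto simp: vec_eq_iff outer_def row_def mat_def axis_def if_distrib sum.distrib
        cong: if_cong)
  \<comment> \<open>Both products equal \<open>E + outer u w\<close>.\<close>
  have "(mat 1 + outer u v) ** E = E ** (mat 1 + outer (axis k 1) w)"
    by (simp add: matrix_add_ldistrib matrix_add_rdistrib matrix_mul_outer outer_mul_matrix Ek w_def)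
  then have "det (mat 1 + outer u v) * det E = det E * det (mat 1 + outer (axis k 1) w)"
    by (metis det_mul)
  then have "det (mat 1 + outer u v) = det (mat 1 + outer (axis k 1) w)"
    using k det_E by simp
  also have "\<dots> = 1 + w $ k"
    unfolding rows cramer_lemma_transpose by (simp add: axis_def)
  also have "w $ k = v \<bullet> u"
    by (simp add: w_def E_def matrix_vector_mult_def transpose_def inner_vec_def mult.commute)
  finally show ?thesis .
qed

lemma det_mat_add_outer:
  fixes u v :: "real^'n"
  assumes "w \<noteq> 0"
  shows "det (mat w + outer u v) = w ^ CARD('n) * (1 + (v \<bullet> u) / w)"
proof -
  have "mat w + outer u v = mat w ** (mat 1 + outer ((1 / w) *\<^sub>R u) v)"
    using assms by (simp add: matrix_add_ldistrib matrix_mul_outer mat_vec)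
  then show ?thesis
    by (simp add: det_mul det_mat det_mat_1_add_outer)
qed

text \<open>With \<open>(w I + a u\<^sup>T) x = b\<close> the matrix factors as \<open>(w I + a u\<^sup>T) (I + x v\<^sup>T)\<close>.\<close>

lemma det_mat_add_two_outer_generic:
  fixes a b u v :: "real^'n"
  assumes w: "w \<noteq> 0" "w + u \<bullet> a \<noteq> 0" and n: "CARD('n) \<ge> 2"
  shows "det (mat w + outer a u + outer b v)
    = w ^ (CARD('n) - 2) * ((w + u \<bullet> a) * (w + v \<bullet> b) - (v \<bullet> a) * (u \<bullet> b))"
proof -
  \<comment> \<open>The Sherman-Morrison formula for the solution of
    \<open>(mat w + outer a u) *v x = b\<close>; the assumptions on \<open>w\<close> keep its
    denominators nonzero.\<close>
  define x where "x = (1 / w) *\<^sub>R (b - ((u \<bullet> b) / (w + u \<bullet> a)) *\<^sub>R a)"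
  have ux: "u \<bullet> x = (u \<bullet> b) / (w + u \<bullet> a)"
  proof -
    have "u \<bullet> b - (u \<bullet> b) / (w + u \<bullet> a) * (u \<bullet> a) = w * ((u \<bullet> b) / (w + u \<bullet> a))"
      using w(2) by (simp add: field_simps)
    then show ?thesis
      using w(1) by (simp add: x_def inner_diff_right)
  qed
  have "(mat w + outer a u) *v x = w *\<^sub>R x + (u \<bullet> x) *\<^sub>R a"
    by (simp add: matrix_vector_mult_add_rdistrib mat_vec outer_vec)
  also have "\<dots> = b"
    unfolding ux using w by (simp add: x_def)
  finally have "mat w + outer a u + outer b v = (mat w + outer a u) ** (mat 1 + outer x v)"
    by (simp add: matrix_add_ldistrib matrix_mul_outer)
  then have "det (mat w + outer a u + outer b v)
      = w ^ CARD('n) * (1 + (u \<bullet> a) / w) * (1 + v \<bullet> x)"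
    using w by (simp add: det_mul det_mat_add_outer det_mat_1_add_outer)
  also have "v \<bullet> x = (v \<bullet> b - (u \<bullet> b) * (v \<bullet> a) / (w + u \<bullet> a)) / w"
    by (simp add: x_def inner_diff_right)
  \<comment> \<open>Two factors \<open>w\<close> are split off, one to clear the denominator of each
    bracket; \<open>n\<close> makes the truncated subtraction exact.\<close>
  also have "w ^ CARD('n) = w ^ (CARD('n) - 2) * w\<^sup>2"
    using n by (simp only: le_add_diff_inverse2 flip: power_add)
  also have "w ^ (CARD('n) - 2) * w\<^sup>2 * (1 + u \<bullet> a / w)
        * (1 + (v \<bullet> b - u \<bullet> b * (v \<bullet> a) / (w + u \<bullet> a)) / w)
      = w ^ (CARD('n) - 2) * ((w * (1 + u \<bullet> a / w))
        * (w * (1 + (v \<bullet> b - u \<bullet> b * (v \<bullet> a) / (w + u \<bullet> a)) / w)))"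
    by (simp add: power2_eq_square)
  also have "w * (1 + u \<bullet> a / w) = w + u \<bullet> a"
    using w by (simp add: field_simps)
  also have "w * (1 + (v \<bullet> b - u \<bullet> b * (v \<bullet> a) / (w + u \<bullet> a)) / w)
      = w + v \<bullet> b - u \<bullet> b * (v \<bullet> a) / (w + u \<bullet> a)"
    using w(1) by (simp add: distrib_left)
  also have "(w + u \<bullet> a) * (w + v \<bullet> b - u \<bullet> b * (v \<bullet> a) / (w + u \<bullet> a))
      = (w + u \<bullet> a) * (w + v \<bullet> b) - (v \<bullet> a) * (u \<bullet> b)"
    using w(2) by (simp add: right_diff_distrib)
  finally show ?thesis .
qed

text \<open>Sylvester's determinant identity for the matrices with columns \<open>a\<close>,
  \<open>b\<close> and \<open>u\<close>, \<open>v\<close>: the last factor is the 2 x 2 determinant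
  of \<open>w\<close> times the identity plus the inner products of \<open>u\<close>,
  \<open>v\<close> with \<open>a\<close>, \<open>b\<close>.\<close>

lemma det_mat_add_two_outer:
  fixes a b u v :: "real^'n"
  assumes n: "CARD('n) \<ge> 2"
  shows "det (mat w + outer a u + outer b v)
    = w ^ (CARD('n) - 2) * ((w + u \<bullet> a) * (w + v \<bullet> b) - (v \<bullet> a) * (u \<bullet> b))"
proof -
  let ?f = "\<lambda>w. det (mat w + outer a u + outer b v)"
  let ?g = "\<lambda>w. w ^ (CARD('n) - 2) * ((w + u \<bullet> a) * (w + v \<bullet> b) - (v \<bullet> a) * (u \<bullet> b))"
  \<comment> \<open>By continuity in \<open>w\<close> the two excluded values are harmless.\<close>
  have entry: "continuous_on UNIV (\<lambda>w. mat w $ i $ j :: real)" for i j :: 'n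
    by (cases "i = j") (simp_all add: mat_def continuous_intros)
  have "continuous_on UNIV ?f"
    unfolding det_def vector_add_component by (intro continuous_intros entry)
  moreover have "continuous_on UNIV ?g"
    by (intro continuous_intros)
  ultimately have "closed {w. ?f w = ?g w}"
    by (rule closed_Collect_eq)
  moreover have "- {0, - (u \<bullet> a)} \<subseteq> {w. ?f w = ?g w}"
    using det_mat_add_two_outer_generic[OF _ _ n, of _ u a b v] by force
  ultimately have "closure (- {0, - (u \<bullet> a)}) \<subseteq> {w. ?f w = ?g w}"
    by (rule closure_minimal[rotated])
  moreover have "closure (- {0, - (u \<bullet> a)}) = UNIV"
    by (simp add: closure_complement empty_interior_finite)
  ultimately show ?thesis by blast
qed

section \<open>The Gram matrix of the search matrix\<close>

lemma dl_param_matrix_vec: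
  "dl_param_matrix y (t, \<nu>) *v x = t *\<^sub>R x + (\<nu> * (y \<bullet> x)) *\<^sub>R y"
  by (simp add: dl_param_matrix_def matrix_vector_mult_add_rdistrib outer_vec
      flip: scaleR_matrix_vector_assoc)

text \<open>Since \<open>transpose P = mat 1 + outer p s + outer q y\<close>, the product is
  \<open>P\<close> plus \<open>outer p (transpose P *v s)\<close> plus
  \<open>outer q (transpose P *v y)\<close>; the two long vectors are these images of
  \<open>s\<close> and \<open>y\<close>.\<close>

lemma gram_rank_two:
  fixes s y p q :: "real^'n"
  defines "P \<equiv> mat 1 + outer s p + outer y q"
  shows "transpose P ** P = mat 1
    + outer s p + outer y q + outer p (s + (s \<bullet> s) *\<^sub>R p + (s \<bullet> y) *\<^sub>R q)
    + outer q (y + (s \<bullet> y) *\<^sub>R p + (y \<bullet> y) *\<^sub>R q)"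
proof -
  have "outer u (v + v') = outer u v + outer u v'" "outer (v + v') u = outer v u + outer v' u" for u v v' :: "real^'n"
    by (simp_all add: outer_def vec_eq_iff algebra_simps)
  moreover have "outer u (c *\<^sub>R v) = c *\<^sub>R outer u v" "outer (c *\<^sub>R u) v = c *\<^sub>R outer u v"
    for u v :: "real^'n" and c
    by (simp_all add: outer_def vec_eq_iff algebra_simps)
  ultimately show ?thesis
    unfolding P_def
    by (simp add: transpose_add transpose_outer matrix_add_ldistrib matrix_add_rdistrib
        matrix_mul_outer outer_vec algebra_simps inner_commute)
qed

text \<open>The vector \<open>T *v s\<close> has a component along \<open>s\<close> and one along
  \<open>y\<close>, hence two outer products. The quotient with \<nu> stays uncancelled so that the
  identity also holds under the convention \<open>x / 0 = 0\<close>.\<close>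

lemma search_matrix_dl:
  "search_matrix s y (dl_param_matrix y (t, \<nu>)) = mat 1
    + outer s ((t / (s \<bullet> y)) *\<^sub>R s - (1 / (s \<bullet> y)) *\<^sub>R y)
    + outer y ((\<nu> * (s \<bullet> y) / (s \<bullet> y)) *\<^sub>R s)"
  unfolding search_matrix_def matrix_mul_outer dl_param_matrix_vec
  by (simp add: outer_def vec_eq_iff algebra_simps inner_commute add_divide_distrib)

text \<open>Here \<open>p\<close> lies in the span of \<open>s\<close> and \<open>y\<close>, and the
  vector paired with \<open>y\<close> is a multiple of \<open>s\<close>. So the four outer products
  regroup into two with left factors \<open>s\<close> and \<open>y\<close>, as the rank-two
  determinant formula requires.\<close>

lemma gram_search_matrix:
  fixes s y :: "real^'n" and t \<nu> :: real
  assumes "s \<bullet> y \<noteq> 0"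
  defines "p \<equiv> (t / (s \<bullet> y)) *\<^sub>R s - (1 / (s \<bullet> y)) *\<^sub>R y"
  defines "P \<equiv> search_matrix s y (dl_param_matrix y (t, \<nu>))"
  defines "r \<equiv> s + (s \<bullet> s) *\<^sub>R p + (\<nu> * (s \<bullet> y)) *\<^sub>R s"
  shows "transpose P ** P = mat 1
    + outer s (p + (t / (s \<bullet> y)) *\<^sub>R r + \<nu> *\<^sub>R (y + (s \<bullet> y) *\<^sub>R p + (\<nu> * (y \<bullet> y)) *\<^sub>R s))
    + outer y (\<nu> *\<^sub>R s - (1 / (s \<bullet> y)) *\<^sub>R r)"
proof -
  have "P = mat 1 + outer s p + outer y (\<nu> *\<^sub>R s)"
    using assms(1) by (simp add: P_def p_def search_matrix_dl)
  then have G: "transpose P ** P = mat 1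
    + outer s p + outer y (\<nu> *\<^sub>R s) + outer p r
    + outer (\<nu> *\<^sub>R s) (y + (s \<bullet> y) *\<^sub>R p + (\<nu> * (y \<bullet> y)) *\<^sub>R s)"
    by (simp add: gram_rank_two r_def mult.commute)
  have "outer p r = (t / (s \<bullet> y)) *\<^sub>R outer s r - (1 / (s \<bullet> y)) *\<^sub>R outer y r"
    by (simp add: p_def outer_def vec_eq_iff left_diff_distrib)
  then show ?thesis
    unfolding G by (simp add: outer_def vec_eq_iff algebra_simps)
qed

section \<open>Singular values\<close>

lemma dl_param_matrix_vec_inner:
  fixes s y :: "real^'n" and t \<nu> :: real
  defines "z \<equiv> dl_param_matrix y (t, \<nu>) *v s"
  shows "z \<bullet> y = t * (s \<bullet> y) + \<nu> * (s \<bullet> y) * (y \<bullet> y)"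
    and "z \<bullet> z = t\<^sup>2 * (s \<bullet> s) + 2 * t * \<nu> * (s \<bullet> y)\<^sup>2 + \<nu>\<^sup>2 * (s \<bullet> y)\<^sup>2 * (y \<bullet> y)"
  by (simp_all add: z_def dl_param_matrix_vec inner_add_left inner_add_right inner_commute
      power2_eq_square algebra_simps)

text \<open>Polarization removes the norms of \<open>z + y\<close> and \<open>z - y\<close>.
  Together with the sum of squares, this product fixes the quadratic whose roots are the squared
  values.\<close>

lemma sigma_mult: "sigma_minus s y T * sigma_plus s y T
    = (s \<bullet> s) * ((T *v s) \<bullet> y) / (s \<bullet> y)\<^sup>2"
proof -
  define z where "z = T *v s"
  have "(norm (z + y) - norm (z - y)) * (norm (z + y) + norm (z - y)) = 4 * (z \<bullet> y)"
    by (simp add: algebra_simps power2_norm_eq_inner inner_commute flip: power2_eq_square)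
  moreover have "sigma_minus s y T * sigma_plus s y T = (norm s)\<^sup>2 / (4 * (s \<bullet> y)\<^sup>2)
      * ((norm (z + y) - norm (z - y)) * (norm (z + y) + norm (z - y)))"
    unfolding sigma_minus_def sigma_plus_def z_def[symmetric] by (simp add: power2_eq_square)
  ultimately show ?thesis
    by (simp add: z_def power2_norm_eq_inner)
qed

text \<open>The mixed terms cancel, and the parallelogram law evaluates the rest.\<close>

lemma sigma_sum_sq: "(sigma_minus s y T)\<^sup>2 + (sigma_plus s y T)\<^sup>2
    = (s \<bullet> s) * ((T *v s) \<bullet> (T *v s) + y \<bullet> y) / (s \<bullet> y)\<^sup>2"
proof -
  define z where "z = T *v s"
  have "(norm (z + y) - norm (z - y))\<^sup>2 + (norm (z + y) + norm (z - y))\<^sup>2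
      = 2 * ((norm (z + y))\<^sup>2 + (norm (z - y))\<^sup>2)"
    by (simp add: power2_eq_square algebra_simps)
  also have "\<dots> = 4 * (z \<bullet> z + y \<bullet> y)"
    by (simp add: power2_norm_eq_inner algebra_simps inner_commute)
  finally have *: "(norm (z + y) - norm (z - y))\<^sup>2 + (norm (z + y) + norm (z - y))\<^sup>2
      = 4 * (z \<bullet> z + y \<bullet> y)" .
  have "(sigma_minus s y T)\<^sup>2 + (sigma_plus s y T)\<^sup>2 = (norm s)\<^sup>2 / (4 * (s \<bullet> y)\<^sup>2)
      * ((norm (z + y) - norm (z - y))\<^sup>2 + (norm (z + y) + norm (z - y))\<^sup>2)"
    unfolding sigma_minus_def sigma_plus_def z_def[symmetric] power_mult_distrib
    by (simp add: power_divide power_mult_distrib distrib_left add_divide_distrib)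
  then show ?thesis
    unfolding * by (simp add: z_def power2_norm_eq_inner del: distrib_left_numeral)
qed

text \<open>By polarization the sign of \<open>(T *v s) \<bullet> y\<close> decides which of the two
  norms is larger. Nonnegative \<nu> and \<open>t\<close> will supply that sign.\<close>

lemma sigma_minus_nonneg:
  assumes "s \<bullet> y > 0" "(T *v s) \<bullet> y \<ge> 0"
  shows "sigma_minus s y T \<ge> 0"
proof -
  have "(norm (T *v s - y))\<^sup>2 \<le> (norm (T *v s + y))\<^sup>2"
    using assms(2) by (simp add: power2_norm_eq_inner algebra_simps inner_commute)
  then have "norm (T *v s - y) \<le> norm (T *v s + y)"
    by (rule power2_le_imp_le) simp
  then show ?thesis
    using assms(1) by (simp add: sigma_minus_def)
qed

lemma has_singular_values_search_matrix:
  fixes s y :: "real^'n"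
  assumes sy: "s \<bullet> y > 0" and n: "CARD('n) \<ge> 2" and "t \<ge> 0" "\<nu> \<ge> 0"
  defines "T \<equiv> dl_param_matrix y (t, \<nu>)"
  shows "has_singular_values (search_matrix s y T)
    (replicate_mset (CARD('n) - 2) 1 + {# sigma_minus s y T, sigma_plus s y T #})"
proof -
  have "(T *v s) \<bullet> y \<ge> 0"
    using assms by (simp add: T_def dl_param_matrix_vec_inner)
  then have nonneg: "sigma_minus s y T \<ge> 0" "sigma_plus s y T \<ge> 0"
    using sy by (simp_all add: sigma_minus_nonneg sigma_plus_def)
  have charpoly: "det (mat x - transpose (search_matrix s y T) ** search_matrix s y T)
      = (x - 1) ^ (CARD('n) - 2) * ((x - (sigma_minus s y T)\<^sup>2) * (x - (sigma_plus s y T)\<^sup>2))" for x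
  proof -
    define b where "b = s \<bullet> y"
    define a where "a = s \<bullet> s"
    define c where "c = y \<bullet> y"
    have b: "b \<noteq> 0" using sy by (simp add: b_def)
    define p where "p = (t / b) *\<^sub>R s - (1 / b) *\<^sub>R y"
    define r where "r = s + a *\<^sub>R p + (\<nu> * b) *\<^sub>R s"
    define u where "u = p + (t / b) *\<^sub>R r + \<nu> *\<^sub>R (y + b *\<^sub>R p + (\<nu> * c) *\<^sub>R s)"
    define v where "v = \<nu> *\<^sub>R s - (1 / b) *\<^sub>R r"
    have G: "transpose (search_matrix s y T) ** search_matrix s y T
        = mat 1 + outer s u + outer y v"
      using gram_search_matrix[of s y t \<nu>] sy
      by (simp add: T_def a_def b_def c_def p_def r_def u_def v_def)
    \<comment> \<open>Absorbing \<open>mat 1\<close> into the scalar part lets the rank-two formula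
      apply with \<open>w = x - 1\<close>, which produces the singular values 1.\<close>
    have "mat x - (mat 1 + outer s u + outer y v) = mat (x - 1) + outer s (- u) + outer y (- v)"
      by (simp add: vec_eq_iff mat_def outer_def)
    then have D: "det (mat x - transpose (search_matrix s y T) ** search_matrix s y T)
      = (x - 1) ^ (CARD('n) - 2) * ((x - 1 - u \<bullet> s) * (x - 1 - v \<bullet> y) - (v \<bullet> s) * (u \<bullet> y))"
      by (simp add: G det_mat_add_two_outer[OF n])
    \<comment> \<open>With \<open>a\<close>, \<open>c\<close>, \<open>t\<close> expressed as multiples of \<open>b\<close> all denominators cancel.\<close>
    define \<alpha> where "\<alpha> = a / b"
    define \<gamma> where "\<gamma> = c / b"
    define \<tau> where "\<tau> = t / b"
    have abs: "a = \<alpha> * b" "c = \<gamma> * b" "t = \<tau> * b"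
      using b by (simp_all add: \<alpha>_def \<gamma>_def \<tau>_def)
    have ps: "p \<bullet> s = \<tau> * a - 1" and py: "p \<bullet> y = t - \<gamma>"
      using b
      by (simp_all add: p_def inner_diff_left a_def b_def c_def \<tau>_def \<gamma>_def inner_commute[of y s])
    have rs: "r \<bullet> s = a + a * (p \<bullet> s) + \<nu> * b * a" and ry: "r \<bullet> y = b + a * (p \<bullet> y) + \<nu> * b * b"
      by (simp_all add: r_def inner_add_left a_def b_def)
    have us: "u \<bullet> s = p \<bullet> s + \<tau> * (r \<bullet> s) + \<nu> * (b + b * (p \<bullet> s) + \<nu> * c * a)"
      and uy: "u \<bullet> y = p \<bullet> y + \<tau> * (r \<bullet> y) + \<nu> * (c + b * (p \<bullet> y) + \<nu> * c * b)"
      by (simp_all add: u_def inner_add_left a_def b_def c_def \<tau>_def inner_commute[of y s])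
    have "v \<bullet> s = \<nu> * a - (r \<bullet> s) / b" and "v \<bullet> y = \<nu> * b - (r \<bullet> y) / b"
      by (simp_all add: v_def inner_diff_left a_def b_def)
    \<comment> \<open>The contributions of \<nu> cancel against those hidden in
      \<open>r\<close>.\<close>
    then have vs: "v \<bullet> s = - (\<alpha>\<^sup>2 * \<tau> * b)" and vy: "v \<bullet> y = \<alpha> * \<gamma> - 1 - \<alpha> * \<tau> * b"
      unfolding rs ry ps py abs using b
      by (simp_all add: add_divide_distrib diff_divide_distrib algebra_simps power2_eq_square)
    have "sigma_minus s y T * sigma_plus s y T = a * (t * b + \<nu> * b * c) / b\<^sup>2"
      by (simp add: sigma_mult T_def dl_param_matrix_vec_inner a_def b_def c_def)
    also have "\<dots> = \<alpha> * b * (\<tau> + \<nu> * \<gamma>)"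
      unfolding abs using b by (simp add: field_simps power2_eq_square)
    finally have prod: "sigma_minus s y T * sigma_plus s y T = \<alpha> * b * (\<tau> + \<nu> * \<gamma>)" .
    have "(sigma_minus s y T)\<^sup>2 + (sigma_plus s y T)\<^sup>2
        = a * (t\<^sup>2 * a + 2 * t * \<nu> * b\<^sup>2 + \<nu>\<^sup>2 * b\<^sup>2 * c + c) / b\<^sup>2"
      by (simp add: sigma_sum_sq T_def dl_param_matrix_vec_inner a_def b_def c_def)
    also have "\<dots> = \<alpha> * (\<tau>\<^sup>2 * \<alpha> * b\<^sup>2 + 2 * \<tau> * \<nu> * b\<^sup>2 + \<nu>\<^sup>2 * b\<^sup>2 * \<gamma> + \<gamma>)"
      unfolding abs using b by (simp add: field_simps power2_eq_square)
    finally have sum: "(sigma_minus s y T)\<^sup>2 + (sigma_plus s y T)\<^sup>2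
        = \<alpha> * (\<tau>\<^sup>2 * \<alpha> * b\<^sup>2 + 2 * \<tau> * \<nu> * b\<^sup>2 + \<nu>\<^sup>2 * b\<^sup>2 * \<gamma> + \<gamma>)" .
    \<comment> \<open>Vieta: only the sum of the squares and the product enter, so no norm of
      \<open>T *v s + y\<close> or \<open>T *v s - y\<close> has to be compared.\<close>
    have "(x - (sigma_minus s y T)\<^sup>2) * (x - (sigma_plus s y T)\<^sup>2)
        = x\<^sup>2 - x * ((sigma_minus s y T)\<^sup>2 + (sigma_plus s y T)\<^sup>2)
          + (sigma_minus s y T * sigma_plus s y T)\<^sup>2"
      by (simp add: power2_eq_square algebra_simps)
    also have "\<dots> = (x - 1 - u \<bullet> s) * (x - 1 - v \<bullet> y) - (v \<bullet> s) * (u \<bullet> y)"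
      unfolding prod sum us uy vs vy rs ry ps py abs
      by (simp add: algebra_simps power2_eq_square)
    finally show ?thesis
      unfolding D by simp
  qed
  show ?thesis
    unfolding has_singular_values_def charpoly using nonneg by auto
qed

section \<open>Residual, linear system and minimizers\<close>

lemma residual_vec:
  "dl_param_matrix y (t, \<nu>) *v s - y = t *\<^sub>R s + (\<nu> * (s \<bullet> y) - 1) *\<^sub>R y"
  by (simp add: dl_param_matrix_vec inner_commute algebra_simps)

lemma residual_sq_eq_0_iff:
  "residual_sq s y (t, \<nu>) = 0 \<longleftrightarrow> t *\<^sub>R s + (\<nu> * (s \<bullet> y) - 1) *\<^sub>R y = 0"
  by (simp add: residual_sq_def residual_vec)

text \<open>The system says that the residual vector, which lies in \<open>span {s, y}\<close>, is orthogonal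
  to both \<open>s\<close> and \<open>y\<close>.\<close>

lemma solves_system_iff: "solves_system s y p \<longleftrightarrow> residual_sq s y p = 0"
proof (cases p)
  case (Pair t \<nu>)
  define r where "r = t *\<^sub>R s + (\<nu> * (s \<bullet> y) - 1) *\<^sub>R y"
  have rs: "r \<bullet> s = (norm s)\<^sup>2 * t + (s \<bullet> y)\<^sup>2 * \<nu> - s \<bullet> y"
    by (simp add: r_def inner_add_left power2_norm_eq_inner inner_commute[of y s]
        power2_eq_square[of "s \<bullet> y"] algebra_simps)
  have ry: "r \<bullet> y = (s \<bullet> y) * t + (s \<bullet> y) * (norm y)\<^sup>2 * \<nu> - (norm y)\<^sup>2"
    by (simp add: r_def inner_add_left power2_norm_eq_inner algebra_simps)
  have "r \<bullet> r = t * (r \<bullet> s) + (\<nu> * (s \<bullet> y) - 1) * (r \<bullet> y)"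
    by (subst (2) r_def) (simp add: inner_add_right)
  then have "r \<bullet> s = 0 \<and> r \<bullet> y = 0 \<longleftrightarrow> r = 0"
    by (metis add_0 inner_eq_zero_iff inner_zero_left mult_zero_right)
  then show ?thesis
    unfolding Pair solves_system_def residual_sq_eq_0_iff r_def[symmetric] rs ry by simp
qed

lemma residual_sq_optimal: "s \<bullet> y \<noteq> 0 \<Longrightarrow> residual_sq s y (0, 1 / (s \<bullet> y)) = 0"
  by (simp add: residual_sq_eq_0_iff)

lemma is_arg_min_residual_sq_iff:
  assumes "s \<bullet> y > 0"
  shows "is_arg_min (residual_sq s y) feasible p \<longleftrightarrow> feasible p \<and> residual_sq s y p = 0"
proof -
  have nonneg: "residual_sq s y p \<ge> 0" for p
    by (simp add: residual_sq_def)
  have "feasible (0, 1 / (s \<bullet> y))"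
    using assms by (simp add: feasible_def)
  moreover have "residual_sq s y (0, 1 / (s \<bullet> y)) = 0"
    using assms by (simp add: residual_sq_optimal)
  ultimately show ?thesis
    unfolding is_arg_min_linorder using nonneg by (metis order_antisym)
qed

text \<open>The norms of \<open>T *v s + y\<close> cancel in the difference, leaving twice the norm
  of \<open>T *v s - y\<close>.\<close>

lemma singular_gap_eq: "singular_gap s y p = norm s / (s \<bullet> y) * sqrt (residual_sq s y p)"
  by (simp add: singular_gap_def sigma_plus_def sigma_minus_def residual_sq_def
      distrib_left right_diff_distrib add_divide_distrib diff_divide_distrib)

lemma is_arg_min_singular_gap_iff:
  assumes "s \<bullet> y > 0"
  shows "is_arg_min (singular_gap s y) feasible p \<longleftrightarrow> is_arg_min (residual_sq s y) feasible p"
proof -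
  \<comment> \<open>Positivity of \<open>s \<bullet> y\<close> excludes \<open>s = 0\<close>, so the
    gap is a strictly increasing function of the residual and all strict comparisons agree.\<close>
  have "norm s / (s \<bullet> y) > 0"
    using assms by (cases "s = 0") simp_all
  then have "singular_gap s y q < singular_gap s y p \<longleftrightarrow> residual_sq s y q < residual_sq s y p" for q
    unfolding singular_gap_eq by (simp only: mult_less_cancel_left_pos real_sqrt_less_iff)
  then show ?thesis
    by (simp add: is_arg_min_def)
qed

text \<open>Under these assumptions \<open>s\<close> and \<open>y\<close> are linearly independent,
  so both coefficients of the residual vector vanish.\<close>

lemma residual_sq_zero_unique:
  assumes "s \<notin> span {y}" "s \<bullet> y \<noteq> 0" "residual_sq s y p = 0"
  shows "p = (0, 1 / (s \<bullet> y))"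
proof (cases p)
  case (Pair t \<nu>)
  have eq: "t *\<^sub>R s = (1 - \<nu> * (s \<bullet> y)) *\<^sub>R y"
    using assms(3) unfolding Pair residual_sq_eq_0_iff
    by (simp add: algebra_simps eq_neg_iff_add_eq_0)
  have "t = 0"
  proof (rule ccontr)
    assume "t \<noteq> 0"
    then have "s = ((1 - \<nu> * (s \<bullet> y)) / t) *\<^sub>R y"
      using eq by (metis divide_inverse mult.commute scaleR_scaleR scaleR_one right_inverse)
    then show False
      using assms(1) by (metis span_base span_scale singletonI)
  qed
  moreover have "y \<noteq> 0"
    using assms(2) by auto
  ultimately have "1 - \<nu> * (s \<bullet> y) = 0"
    using eq by (metis scaleR_eq_0_iff scaleR_zero_left)
  then show ?thesis
    using \<open>t = 0\<close> assms(2) by (simp add: Pair field_simps)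
qed

lemma residual_sq_zero_not_unique:
  assumes "s \<in> span {y}" "s \<bullet> y > 0"
  obtains p where "feasible p" "residual_sq s y p = 0" "p \<noteq> (0, 1 / (s \<bullet> y))"
proof -
  obtain k where k: "s = k *\<^sub>R y"
    using assms(1) by (auto simp: span_singleton)
  \<comment> \<open>\<open>s \<bullet> y\<close> is \<open>k\<close> times the nonnegative
    \<open>y \<bullet> y\<close>; the sign of \<open>k\<close> makes the second zero
    feasible.\<close>
  then have "k > 0"
    using assms(2) by (simp add: zero_less_mult_iff not_less inner_ge_zero leD)
  then have "feasible (1 / k, 0)" "residual_sq s y (1 / k, 0) = 0"
    by (simp_all add: feasible_def residual_sq_eq_0_iff k)
  moreover have "(1 / k, 0) \<noteq> (0, 1 / (s \<bullet> y))"
    using assms(2) by simp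
  ultimately show thesis by (rule that)
qed

theorem mainTheorem6:
  fixes s y :: "real^'n"
  assumes "s \<bullet> y > 0"
  shows
    "(CARD('n) \<ge> 2 \<longrightarrow>
       (\<forall>p. feasible p \<longrightarrow>
         has_singular_values (search_matrix s y (dl_param_matrix y p))
           (replicate_mset (CARD('n) - 2) 1 +
            {# sigma_minus s y (dl_param_matrix y p), sigma_plus s y (dl_param_matrix y p) #})))
     \<and> (\<forall>p. is_arg_min (singular_gap s y) feasible p
             \<longleftrightarrow> is_arg_min (residual_sq s y) feasible p)
     \<and> (\<forall>p. is_arg_min (residual_sq s y) feasible p \<longleftrightarrow> feasible p \<and> solves_system s y p)
     \<and> solves_system s y (0, 1 / (s \<bullet> y))
     \<and> is_arg_min (residual_sq s y) feasible (0, 1 / (s \<bullet> y))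
     \<and> ({p. solves_system s y p} = {(0, 1 / (s \<bullet> y))} \<longleftrightarrow> s \<notin> span {y})
     \<and> ({p. is_arg_min (residual_sq s y) feasible p} = {(0, 1 / (s \<bullet> y))} \<longleftrightarrow> s \<notin> span {y})"
proof -
  let ?opt = "(0, 1 / (s \<bullet> y))"
  have opt: "feasible ?opt" "residual_sq s y ?opt = 0"
    using assms by (simp_all add: feasible_def residual_sq_optimal)
  \<comment> \<open>Any \<open>P\<close> between the feasible zeros and all zeros of the residual is
    covered, since the second zero is feasible. This serves both the solutions of the system and the
    minimizers.\<close>
  have unique: "Collect P = {?opt} \<longleftrightarrow> s \<notin> span {y}"
    if P: "\<And>p. P p \<Longrightarrow> residual_sq s y p = 0" "\<And>p. feasible p \<Longrightarrow> residual_sq s y p = 0 \<Longrightarrow> P p"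
    for P
  proof
    assume *: "Collect P = {?opt}"
    show "s \<notin> span {y}"
    proof
      assume "s \<in> span {y}"
      then obtain p where "feasible p" "residual_sq s y p = 0" "p \<noteq> ?opt"
        using assms by (rule residual_sq_zero_not_unique)
      then show False
        using P(2) * by blast
    qed
  next
    assume "s \<notin> span {y}"
    then have "p = ?opt" if "P p" for p
      using assms by (intro residual_sq_zero_unique P(1) that) simp_all
    moreover have "P ?opt"
      using opt by (rule P(2))
    ultimately show "Collect P = {?opt}"
      by blast
  qed
  have "{p. residual_sq s y p = 0} = {?opt} \<longleftrightarrow> s \<notin> span {y}"
    "{p. feasible p \<and> residual_sq s y p = 0} = {?opt} \<longleftrightarrow> s \<notin> span {y}"
    by (rule unique; simp)+
  moreover have "has_singular_values (search_matrix s y (dl_param_matrix y p))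
      (replicate_mset (CARD('n) - 2) 1 +
        {# sigma_minus s y (dl_param_matrix y p), sigma_plus s y (dl_param_matrix y p) #})"
    if "CARD('n) \<ge> 2" "feasible p" for p
    using that has_singular_values_search_matrix[OF assms] by (cases p) (simp add: feasible_def)
  ultimately show ?thesis
    unfolding is_arg_min_singular_gap_iff[OF assms] is_arg_min_residual_sq_iff[OF assms]
      solves_system_iff
    using opt by blast
qed

end
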